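(* $\mathfrak{sp}'\leq\mathfrak{l}$.
   Context: A compactification $\alpha\omega$ of the countable discrete space $\omega$ is a compact Hausdorff space containing $\omega$ as a dense subspace. $\alpha\omega\leq\gamma\omega$ means there is a continuous surjection $f:\gamma\omega\to\alpha\omega$ whose restriction to $\omega$ is the identity; $\alpha\omega\simeq\gamma\omega$ means such an $f$ can be chosen to be a homeomorphism. Modulo $\simeq$, compactifications of $\omega$ ordered by $\leq$ form a complete upper semilattice with largest element the Stone–Čech compactification $\beta\omega$; $\sup$ is taken in it. $C_{\alpha\omega}$ denotes the set of bounded functions $\omega\to\mathbb{R}$ that extend continuously over $\alpha\omega$; it determines $\alpha\omega$ up to $\simeq$, and every subring of the ring of bounded functions on $\omega$ that is closed in the uniform norm, contains all constants and generates the topology of $\omega$ is of this form. $\mathrm{M}(\omega)$ is the set of all metrics on $\omega$ compatible with the discrete topology. For $d\in\mathrm{M}(\omega)$, the Smirnov compactification $u_d\omega$ is the compactification with $C_{u_d\omega}=U^*_d(\omega)$, the ring of all bounded uniformly continuous functions from $(\omega,d)$ to $\mathbb{R}$. $\mathrm{M}'(\omega)$ is the set of $d\in\mathrm{M}(\omega)$ with $\beta\omega\not\simeq u_d\omega$. For $d_1,d_2\in\mathrm{M}(\omega)$, $d_1\preceq d_2$ means $U^*_{d_1}(\omega)\subseteq U^*_{d_2}(\omega)$ (equivalently $u_{d_1}\omega\leq u_{d_2}\omega$). $\mathfrak{sp}'$ is the smallest cardinality of a set $D\subseteq\mathrm{M}'(\omega)$ that is directed with respect to $\preceq$ (for any $d_1,d_2\in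 D$ there is $d\in D$ with $d_1\preceq d$ and $d_2\preceq d$) and satisfies $\beta\omega\simeq\sup\{u_d\omega: d\in D\}$. $\mathcal{S}=\prod_{n<\omega}[\omega]^{\leq n+1}$; its elements are called slaloms. $\mathfrak{l}$ is the smallest cardinal $\kappa$ such that for every $h\in\omega^\omega$ there is a set $\Phi\subseteq\mathcal{S}$ of size $\kappa$ such that for every $f\in\prod_{n<\omega}h(n)$ there is $\varphi\in\Phi$ with $f(n)\in\varphi(n)$ for all but finitely many $n<\omega$ (here $h(n)=\{0,\dots,h(n)-1\}$). Convention: if no set of the required kind exists, the cardinal being defined is $\infty$, and $\lambda<\infty$ for every cardinal $\lambda$. *)

theory Defs
  imports "HOL-Analysis.Analysis"
begin

unbundle cardinal_syntax

text \<open>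
  A cardinal is represented by a cardinal order, unique up to \<open>=o\<close>; \<open>None\<close> stands for \<open>\<infinity>\<close>.
  The carrier type \<open>'a\<close> of \<open>least_cardinal\<close> bounds the cardinals it ranges over. Below, the
  property in question only ever holds for the cardinality of a set of elements of \<open>'a\<close>,
  so nothing is lost.
\<close>

definition least_cardinal :: "('a rel \<Rightarrow> bool) \<Rightarrow> 'a rel option" where
  "least_cardinal P =
     (if \<exists>\<kappa>. Card_order \<kappa> \<and> P \<kappa>
      then Some (SOME \<kappa>. Card_order \<kappa> \<and> P \<kappa> \<and> (\<forall>\<mu>. Card_order \<mu> \<and> P \<mu> \<longrightarrow> \<kappa> \<le>o \<mu>))
      else None)"

fun ext_card_le :: "'a rel option \<Rightarrow> 'b rel option \<Rightarrow> bool" (infix "\<le>\<^sub>\<infinity>" 50) where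
  "(_ \<le>\<^sub>\<infinity> None) = True"
| "(None \<le>\<^sub>\<infinity> Some _) = False"
| "(Some \<kappa> \<le>\<^sub>\<infinity> Some \<mu>) = (\<kappa> \<le>o \<mu>)"

text \<open>A space \<open>X\<close> together with the embedding \<open>e\<close> of the natural numbers.\<close>

type_synonym 'a cptf = "'a topology \<times> (nat \<Rightarrow> 'a)"

definition compactification :: "'a cptf \<Rightarrow> bool" where
  "compactification K \<longleftrightarrow>
     (case K of (X, e) \<Rightarrow>
        compact_space X \<and> Hausdorff_space X \<and>
        embedding_map (discrete_topology UNIV) X e \<and>
        X closure_of (range e) = topspace X)"

definition cptf_le :: "'a cptf \<Rightarrow> 'b cptf \<Rightarrow> bool" where
  "cptf_le K L \<longleftrightarrow>
     (case K of (X, e) \<Rightarrow> case L of (Y, i) \<Rightarrow>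
        \<exists>f. continuous_map Y X f \<and> f ` topspace Y = topspace X \<and> (\<forall>n. f (i n) = e n))"

definition cptf_equiv :: "'a cptf \<Rightarrow> 'b cptf \<Rightarrow> bool" where
  "cptf_equiv K L \<longleftrightarrow>
     (case K of (X, e) \<Rightarrow> case L of (Y, i) \<Rightarrow>
        \<exists>f. homeomorphic_map Y X f \<and> (\<forall>n. f (i n) = e n))"

definition cptf_ring :: "'a cptf \<Rightarrow> (nat \<Rightarrow> real) set" where
  "cptf_ring K =
     (case K of (X, e) \<Rightarrow>
        {f. bounded (range f) \<and>
            (\<exists>F. continuous_map X euclideanreal F \<and> (\<forall>n. F (e n) = f n))})"

text \<open>
  Every compactification \<open>(X, e)\<close> is equivalent to one whose points have type
  \<open>(nat \<Rightarrow> real) \<Rightarrow> real\<close>: send \<open>x\<close> to the map taking each \<open>f\<close> in \<open>cptf_ring (X, e)\<close> to the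
  value at \<open>x\<close> of the extension of \<open>f\<close> (and every other \<open>f\<close> to 0). This type is therefore
  large enough to carry the semilattice of all compactifications modulo equivalence.
  The three choices below pick a representative of a class that is unique up to equivalence.
\<close>

type_synonym omega_cptf = "((nat \<Rightarrow> real) \<Rightarrow> real) cptf"

definition stone_cech :: omega_cptf where
  "stone_cech = (SOME K. compactification K \<and>
     (\<forall>L :: omega_cptf. compactification L \<longrightarrow> cptf_le L K))"

definition cptf_sup :: "omega_cptf set \<Rightarrow> omega_cptf" where
  "cptf_sup \<K> = (SOME K. compactification K \<and> (\<forall>L\<in>\<K>. cptf_le L K) \<and>
     (\<forall>K' :: omega_cptf. compactification K' \<and> (\<forall>L\<in>\<K>. cptf_le L K') \<longrightarrow> cptf_le K K'))"

definition discrete_metrics :: "(nat \<Rightarrow> nat \<Rightarrow> real) set" where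
  "discrete_metrics =
     {d. Metric_space UNIV d \<and> Metric_space.mtopology UNIV d = discrete_topology UNIV}"

definition bdd_ucont :: "(nat \<Rightarrow> nat \<Rightarrow> real) \<Rightarrow> (nat \<Rightarrow> real) set" where
  "bdd_ucont d =
     {f. bounded (range f) \<and> uniformly_continuous_map (metric (UNIV, d)) euclidean_metric f}"

definition smirnov :: "(nat \<Rightarrow> nat \<Rightarrow> real) \<Rightarrow> omega_cptf" where
  "smirnov d = (SOME K. compactification K \<and> cptf_ring K = bdd_ucont d)"

definition metrics_not_beta :: "(nat \<Rightarrow> nat \<Rightarrow> real) set" where
  "metrics_not_beta = {d \<in> discrete_metrics. \<not> cptf_equiv stone_cech (smirnov d)}"

definition metric_preceq :: "(nat \<Rightarrow> nat \<Rightarrow> real) \<Rightarrow> (nat \<Rightarrow> nat \<Rightarrow> real) \<Rightarrow> bool" where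
  "metric_preceq d\<^sub>1 d\<^sub>2 \<longleftrightarrow> bdd_ucont d\<^sub>1 \<subseteq> bdd_ucont d\<^sub>2"

definition metric_directed :: "(nat \<Rightarrow> nat \<Rightarrow> real) set \<Rightarrow> bool" where
  "metric_directed D \<longleftrightarrow>
     (\<forall>d\<^sub>1\<in>D. \<forall>d\<^sub>2\<in>D. \<exists>d\<in>D. metric_preceq d\<^sub>1 d \<and> metric_preceq d\<^sub>2 d)"

definition sp_prime :: "(nat \<Rightarrow> nat \<Rightarrow> real) rel option" where
  "sp_prime = least_cardinal (\<lambda>\<kappa>. \<exists>D. |D| =o \<kappa> \<and> D \<subseteq> metrics_not_beta \<and>
     metric_directed D \<and> cptf_equiv stone_cech (cptf_sup (smirnov ` D)))"

definition slaloms :: "(nat \<Rightarrow> nat set) set" where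
  "slaloms = {\<phi>. \<forall>n. finite (\<phi> n) \<and> card (\<phi> n) \<le> n + 1}"

definition localization_number :: "(nat \<Rightarrow> nat set) rel option" where
  "localization_number = least_cardinal (\<lambda>\<kappa>. \<forall>h :: nat \<Rightarrow> nat. \<exists>\<Phi>. \<Phi> \<subseteq> slaloms \<and> |\<Phi>| =o \<kappa> \<and>
     (\<forall>f. (\<forall>n. f n < h n) \<longrightarrow> (\<exists>\<phi>\<in>\<Phi>. \<forall>\<^sub>F n in sequentially. f n \<in> \<phi> n)))"

end

theory Submission
  imports Defs
begin

text \<open>
  Split \<open>\<omega>\<close> into finite blocks, the \<open>n\<close>-th having more than \<open>(2n + 3)\<close> to the power \<open>(n + 1)\<^sup>2\<close>
  points. A bounded function, rounded to precision \<open>1 / (n + 1)\<close> on the \<open>n\<close>-th block, is coded there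
  by one of finitely many patterns, so a family \<open>\<Phi>\<close> of slaloms localizes all these codes. A finite
  \<open>F \<subseteq> \<Phi>\<close> gives a metric in which two points of the \<open>n\<close>-th block are at distance \<open>1 / (n + 1)\<close> if no
  pattern allowed by a member of \<open>F\<close> tells them apart, and all other distances are 1. These metrics
  are directed by inclusion of the sets \<open>F\<close>, and every bounded function is uniformly continuous for
  one of them. Yet for \<open>n \<ge> card F\<close> at most \<open>(n + 1)\<^sup>2\<close> patterns are allowed, so by the pigeonhole
  principle some two points of the \<open>n\<close>-th block are at distance \<open>1 / (n + 1)\<close>, and the metric does
  not yield \<open>\<beta>\<omega>\<close>.
\<close>

section \<open>Compactifications and their rings\<close>

text \<open>
  The first two instances are needed only because the library declares function spaces with countable
  domain to be metric: a direct \<open>t2_space\<close> instance for arbitrary domains would clash with the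
  arities inherited from there.
\<close>

instance "fun" :: (type, t0_space) t0_space
proof
  fix f g :: "'a \<Rightarrow> 'b"
  assume "f \<noteq> g"
  then obtain x where "f x \<noteq> g x" by auto
  then obtain U where U: "open U" "f x \<in> U \<longleftrightarrow> g x \<notin> U"
    by (auto simp: separation_t0)
  have "open ((\<lambda>h::'a\<Rightarrow>'b. h x) -` U)" 
    by (auto intro!: open_vimage U continuous_on_product_coordinates)
  with U show "\<exists>U. open U \<and> \<not> (f \<in> U \<longleftrightarrow> g \<in> U)"
    by (intro exI[of _ "(\<lambda>h. h x) -` U"]) auto
qed

instance "fun" :: (type, t1_space) t1_space
proof
  fix f g :: "'a \<Rightarrow> 'b"
  assume "f \<noteq> g"
  then obtain x where "f x \<noteq> g x" by auto
  then obtain U where U: "open U" "f x \<in> U" "g x \<notin> U"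
    using t1_space by metis
  have "open ((\<lambda>h::'a\<Rightarrow>'b. h x) -` U)" 
    by (auto intro!: open_vimage U continuous_on_product_coordinates)
  with U show "\<exists>U. open U \<and> f \<in> U \<and> g \<notin> U"
    by (intro exI[of _ "(\<lambda>h. h x) -` U"]) auto
qed

instance "fun" :: (type, t2_space) t2_space
proof
  fix f g :: "'a \<Rightarrow> 'b"
  assume "f \<noteq> g"
  then obtain x where "f x \<noteq> g x" by auto
  then obtain U V where UV: "open U" "open V" "f x \<in> U" "g x \<in> V" "U \<inter> V = {}"
    using hausdorff by metis
  have "open ((\<lambda>h::'a\<Rightarrow>'b. h x) -` U)" "open ((\<lambda>h::'a\<Rightarrow>'b. h x) -` V)"
    by (auto intro!: open_vimage UV continuous_on_product_coordinates)
  with UV show "\<exists>U V. open U \<and> open V \<and> f \<in> U \<and> g \<in> V \<and> U \<inter> V = {}"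
    by (intro exI[of _ "(\<lambda>h. h x) -` U"] exI[of _ "(\<lambda>h. h x) -` V"]) auto
qed

lemma Hausdorff_euclidean_t2: "Hausdorff_space (euclidean :: 'a::t2_space topology)"
  unfolding Hausdorff_space_def by (simp add: disjnt_def) (metis hausdorff)

section \<open>Continuous functions on a compactification\<close>

lemma compactification_dense_eq:
  assumes "compactification (X, e)" "Hausdorff_space Y"
    and "continuous_map X Y f" "continuous_map X Y g"
    and "\<And>n. f (e n) = g (e n)" "x \<in> topspace X"
  shows "f x = g x"
  using assms unfolding compactification_def
  by (intro forall_in_closure_of_eq[of x X "range e" Y f g]) auto

lemma compactification_in_topspace:
  assumes "compactification (X, e)"
  shows "e n \<in> topspace X"
proof -
  have "embedding_map (discrete_topology UNIV) X e"
    using assms by (simp add: compactification_def)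
  then have "e ` topspace (discrete_topology UNIV) \<subseteq> topspace X"
    by (metis embedding_map_def homeomorphic_imp_surjective_map inf.cobounded1 topspace_subtopology)
  then show ?thesis by auto
qed

lemma cptf_ring_bounded: "cptf_ring K \<subseteq> {f. bounded (range f)}"
  by (auto simp: cptf_ring_def split: prod.splits)

lemma cptf_ringI:
  assumes K: "compactification (X, e)" and F: "continuous_map X euclideanreal F"
  shows "(\<lambda>n. F (e n)) \<in> cptf_ring (X, e)"
proof -
  have "compactin X (topspace X)"
    using K by (simp add: compactification_def compact_space_def)
  then have "compact (F ` topspace X)"
    using image_compactin[OF _ F] by force
  then have "bounded (F ` topspace X)" by (rule compact_imp_bounded)
  then have "bounded (range (\<lambda>n. F (e n)))"
    by (rule bounded_subset) (use compactification_in_topspace[OF K] in auto)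
  then show ?thesis
    using F unfolding cptf_ring_def by auto
qed

lemma compactification_separating:
  assumes K: "compactification (X, e)" and xy: "x \<in> topspace X" "y \<in> topspace X" "x \<noteq> y"
  obtains F where "continuous_map X euclideanreal F" "F x \<noteq> F y"
proof -
  have "compact_space X" "Hausdorff_space X"
    using K by (auto simp: compactification_def)
  then have "completely_regular_space X"
    by (simp add: compact_Hausdorff_or_regular_imp_normal_space normal_imp_completely_regular_space)
  moreover have "closedin X {y}"
    using \<open>Hausdorff_space X\<close> xy by (simp add: closedin_Hausdorff_singleton)
  ultimately obtain F where "continuous_map X euclideanreal F" "F x = 0" "F ` {y} \<subseteq> {1}"
    unfolding completely_regular_space_alt using xy by blast
  then show ?thesis
    by (intro that[of F]) auto
qed

section \<open>Compactifications as closures of evaluation maps\<close>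

definition eval_point :: "(nat \<Rightarrow> real) set \<Rightarrow> nat \<Rightarrow> (nat \<Rightarrow> real) \<Rightarrow> real" where
  "eval_point R n f = (if f \<in> R then f n else 0)"

text \<open>The classical embedding into a power of the reals. The default 0 in
  \<open>eval_point\<close> freezes the coordinates outside \<open>R\<close>, so that one carrier
  type serves every \<open>R\<close> and those coordinates never separate points of the
  closure.\<close>

definition canonical_cptf :: "(nat \<Rightarrow> real) set \<Rightarrow> omega_cptf" where
  "canonical_cptf R = (top_of_set (closure (range (eval_point R))), eval_point R)"

lemma compact_closure_eval_points:
  assumes "\<And>f. f \<in> R \<Longrightarrow> bounded (range f)"
  shows "compact (closure (range (eval_point R)))"
proof -
  have "\<forall>f\<in>R. \<exists>M. \<forall>n. \<bar>f n\<bar> \<le> M"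
    using assms by (auto simp: bounded_iff)
  then obtain M where M: "\<And>f n. f \<in> R \<Longrightarrow> \<bar>f n\<bar> \<le> M f" by metis
  \<comment> \<open>A Tychonoff box around the evaluation points. Coordinates outside
    \<open>R\<close> get the degenerate interval \<open>{0}\<close>.\<close>
  define S :: "((nat \<Rightarrow> real) \<Rightarrow> real) set" where
    "S = PiE UNIV (\<lambda>f. cball 0 (if f \<in> R then M f else 0))"
  have "compactin (product_topology (\<lambda>_. euclideanreal) UNIV) S"
    unfolding S_def compactin_PiE by auto
  then have "compact S"
    by (simp add: euclidean_product_topology)
  moreover have "range (eval_point R) \<subseteq> S"
    using M by (auto simp: S_def eval_point_def)
  ultimately show ?thesis
    by (metis closure_minimal compact_Int_closed compact_imp_closed closed_closure inf.absorb2)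
qed

lemma continuous_map_into_fun:
  "continuous_map X (euclidean :: ('i \<Rightarrow> 'b::topological_space) topology) f \<longleftrightarrow>
     (\<forall>k. continuous_map X euclidean (\<lambda>x. f x k))"
  by (metis continuous_map_componentwise_UNIV euclidean_product_topology)

text \<open>A point \<open>y\<close> goes to the family of values at \<open>y\<close> of the
  extensions of members of \<open>R\<close>. The image is compact, hence closed, and contains all
  evaluation points, hence is their whole closure. The last clause, which rests on uniqueness of
  extensions, serves to prove injectivity when \<open>R\<close> is the full ring.\<close>

lemma canonical_cptf_map:
  assumes L: "compactification (Y, i)" and R: "R \<subseteq> cptf_ring (Y, i)"
  obtains \<phi> where "continuous_map Y (fst (canonical_cptf R)) \<phi>"
    "\<phi> ` topspace Y = topspace (fst (canonical_cptf R))"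
    "\<And>n. \<phi> (i n) = eval_point R n"
    "\<And>F y. continuous_map Y euclideanreal F \<Longrightarrow> (\<lambda>n. F (i n)) \<in> R \<Longrightarrow> y \<in> topspace Y \<Longrightarrow>
        \<phi> y (\<lambda>n. F (i n)) = F y"
proof -
  have "\<forall>f\<in>R. \<exists>F. continuous_map Y euclideanreal F \<and> (\<forall>n. F (i n) = f n)"
    using R by (auto simp: cptf_ring_def)
  then obtain E where E: "\<And>f. f \<in> R \<Longrightarrow> continuous_map Y euclideanreal (E f)"
      "\<And>f n. f \<in> R \<Longrightarrow> E f (i n) = f n"
    by metis
  define \<phi> where "\<phi> y f = (if f \<in> R then E f y else 0)" for y f
  let ?C = "closure (range (eval_point R))"
  have top: "topspace (fst (canonical_cptf R)) = ?C"
    by (simp add: canonical_cptf_def)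
  have \<phi>_i: "\<phi> (i n) = eval_point R n" for n
    by (auto simp: \<phi>_def eval_point_def E)
  have cont: "continuous_map Y euclidean \<phi>"
    unfolding continuous_map_into_fun by (auto simp: \<phi>_def E)
  have comp: "compactin Y (topspace Y)" and dense: "Y closure_of range i = topspace Y"
    using L by (auto simp: compactification_def compact_space_def)
  have "\<phi> ` topspace Y \<subseteq> ?C"
    using continuous_map_image_closure_subset[OF cont, of "range i"]
    by (auto simp: dense \<phi>_i image_image)
  moreover have "?C \<subseteq> \<phi> ` topspace Y"
  proof (rule closure_minimal)
    show "range (eval_point R) \<subseteq> \<phi> ` topspace Y"
      using \<phi>_i compactification_in_topspace[OF L] by (metis image_eqI image_subsetI)
    have "compact (\<phi> ` topspace Y)"
      using image_compactin[OF comp cont] by simp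
    then show "closed (\<phi> ` topspace Y)" by (rule compact_imp_closed)
  qed
  ultimately have im: "\<phi> ` topspace Y = ?C" by auto
  show ?thesis
  proof (rule that[of \<phi>])
    show "continuous_map Y (fst (canonical_cptf R)) \<phi>"
      using cont im by (simp add: canonical_cptf_def continuous_map_in_subtopology flip: image_subset_iff_funcset)
    show "\<phi> y (\<lambda>n. F (i n)) = F y"
      if "continuous_map Y euclideanreal F" "(\<lambda>n. F (i n)) \<in> R" "y \<in> topspace Y" for F y
    proof -
      have "E (\<lambda>n. F (i n)) y = F y"
        by (rule compactification_dense_eq[OF L, where Y = euclideanreal]) (use that E in auto)
      then show ?thesis using that by (simp add: \<phi>_def)
    qed
  qed (use im top \<phi>_i in auto)
qed

text \<open>Every continuous real function on \<open>X\<close> is a coordinate of the map into the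
  canonical space, and such functions separate points. So that map is a continuous bijection from a
  compact space to a Hausdorff space.\<close>

lemma canonical_cptf_homeomorphic:
  assumes K: "compactification (X, e)"
  obtains \<phi> where "homeomorphic_map X (fst (canonical_cptf (cptf_ring (X, e)))) \<phi>"
    "\<And>n. \<phi> (e n) = eval_point (cptf_ring (X, e)) n"
proof -
  obtain \<phi> where \<phi>: "continuous_map X (fst (canonical_cptf (cptf_ring (X, e)))) \<phi>"
    "\<phi> ` topspace X = topspace (fst (canonical_cptf (cptf_ring (X, e))))"
    "\<And>n. \<phi> (e n) = eval_point (cptf_ring (X, e)) n"
    "\<And>F y. continuous_map X euclideanreal F \<Longrightarrow> (\<lambda>n. F (e n)) \<in> cptf_ring (X, e) \<Longrightarrow>
        y \<in> topspace X \<Longrightarrow> \<phi> y (\<lambda>n. F (e n)) = F y"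
    using canonical_cptf_map[OF K order_refl] by blast
  have "inj_on \<phi> (topspace X)"
  proof (rule inj_onI, rule ccontr)
    fix x y assume xy: "x \<in> topspace X" "y \<in> topspace X" "\<phi> x = \<phi> y" "x \<noteq> y"
    then obtain F where F: "continuous_map X euclideanreal F" "F x \<noteq> F y"
      using compactification_separating[OF K] by metis
    then show False
      using \<phi>(4)[OF F(1) cptf_ringI[OF K F(1)]] xy by metis
  qed
  moreover have "Hausdorff_space (fst (canonical_cptf (cptf_ring (X, e))))"
    by (simp add: canonical_cptf_def Hausdorff_space_subtopology Hausdorff_euclidean_t2)
  moreover have "compact_space X"
    using K by (simp add: compactification_def)
  ultimately have "homeomorphic_map X (fst (canonical_cptf (cptf_ring (X, e)))) \<phi>"
    using \<phi> by (intro continuous_imp_homeomorphic_map) auto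
  with \<phi> show ?thesis using that by blast
qed

section \<open>The order of compactifications in terms of their rings\<close>

lemma cptf_ring_subset_imp_le:
  assumes K: "compactification K" and L: "compactification L"
    and sub: "cptf_ring K \<subseteq> cptf_ring L"
  shows "cptf_le K L"
proof -
  obtain X e Y i where KL: "K = (X, e)" "L = (Y, i)" by (cases K, cases L)
  let ?C = "fst (canonical_cptf (cptf_ring (X, e)))"
  obtain \<phi> where \<phi>: "homeomorphic_map X ?C \<phi>" "\<And>n. \<phi> (e n) = eval_point (cptf_ring (X, e)) n"
    using canonical_cptf_homeomorphic K KL by blast
  then obtain \<phi>' where \<phi>': "homeomorphic_maps X ?C \<phi> \<phi>'"
    by (auto simp: homeomorphic_map_maps)
  then have inv: "homeomorphic_map ?C X \<phi>'" "\<And>x. x \<in> topspace X \<Longrightarrow> \<phi>' (\<phi> x) = x"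
    by (auto simp: homeomorphic_maps_map)
  \<comment> \<open>The canonical space of the smaller ring is a copy of \<open>X\<close> and, by
    the inclusion of rings, also an image of \<open>Y\<close>.\<close>
  obtain \<psi> where \<psi>: "continuous_map Y ?C \<psi>" "\<psi> ` topspace Y = topspace ?C"
    "\<And>n. \<psi> (i n) = eval_point (cptf_ring (X, e)) n"
    using canonical_cptf_map[OF L[unfolded KL] sub[unfolded KL]] by metis
  have "continuous_map Y X (\<phi>' \<circ> \<psi>)"
    using \<psi>(1) inv(1) continuous_map_compose homeomorphic_imp_continuous_map by blast
  moreover have "(\<phi>' \<circ> \<psi>) ` topspace Y = topspace X"
    using \<psi>(2) homeomorphic_imp_surjective_map[OF inv(1)] by (metis image_comp)
  moreover have "(\<phi>' \<circ> \<psi>) (i n) = e n" for n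
    using inv(2)[of "e n"] compactification_in_topspace[of X e n] K KL by (simp add: \<psi> \<phi>)
  ultimately show ?thesis
    unfolding cptf_le_def KL by (auto intro!: exI[of _ "\<phi>' \<circ> \<psi>"])
qed

lemma cptf_le_imp_ring_subset:
  assumes "cptf_le K L"
  shows "cptf_ring K \<subseteq> cptf_ring L"
proof -
  obtain X e Y i where KL: "K = (X, e)" "L = (Y, i)" by (cases K, cases L)
  obtain g where g: "continuous_map Y X g" "\<And>n. g (i n) = e n"
    using assms by (auto simp: cptf_le_def KL)
  show ?thesis
  proof
    fix f assume "f \<in> cptf_ring K"
    then obtain F where F: "bounded (range f)" "continuous_map X euclideanreal F" "\<And>n. F (e n) = f n"
      by (auto simp: cptf_ring_def KL)
    then have "continuous_map Y euclideanreal (F \<circ> g)"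
      using g continuous_map_compose by blast
    with F g show "f \<in> cptf_ring L"
      unfolding cptf_ring_def KL by (auto intro!: exI[of _ "F \<circ> g"])
  qed
qed

lemma cptf_le_antisym:
  assumes K: "compactification K" and L: "compactification L"
    and "cptf_le K L" "cptf_le L K"
  shows "cptf_equiv K L"
proof -
  obtain X e Y i where KL: "K = (X, e)" "L = (Y, i)" by (cases K, cases L)
  obtain f g where f: "continuous_map Y X f" "\<And>n. f (i n) = e n"
    and g: "continuous_map X Y g" "\<And>n. g (e n) = i n"
    using assms by (auto simp: cptf_le_def KL)
  have XY: "Hausdorff_space X" "Hausdorff_space Y"
    using K L by (auto simp: KL compactification_def)
  \<comment> \<open>Both composites fix the dense copy of \<omega>, hence everything.\<close>
  have "(f \<circ> g) x = id x" if "x \<in> topspace X" for x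
    by (rule compactification_dense_eq[OF K[unfolded KL] XY(1) continuous_map_compose[OF g(1) f(1)]
          continuous_map_id _ that]) (simp add: f g)
  moreover have "(g \<circ> f) y = id y" if "y \<in> topspace Y" for y
    by (rule compactification_dense_eq[OF L[unfolded KL] XY(2) continuous_map_compose[OF f(1) g(1)]
          continuous_map_id _ that]) (simp add: f g)
  ultimately have "homeomorphic_maps Y X f g"
    using f g by (auto simp: homeomorphic_maps_def)
  then show ?thesis
    using f unfolding cptf_equiv_def KL by (auto simp: homeomorphic_map_maps)
qed

lemma cptf_equiv_imp_le: "cptf_equiv K L \<Longrightarrow> cptf_le K L"
  unfolding cptf_equiv_def cptf_le_def
  by (auto split: prod.splits)
    (metis homeomorphic_imp_continuous_map homeomorphic_imp_surjective_map)

section \<open>From rings of bounded functions to compactifications\<close>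

lemma compactification_canonical:
  assumes bdd: "\<And>f. f \<in> R \<Longrightarrow> bounded (range f)"
    and isol: "\<And>n. \<exists>f\<in>R. \<exists>\<epsilon>>0. \<forall>m. m \<noteq> n \<longrightarrow> \<epsilon> \<le> \<bar>f m - f n\<bar>"
  shows "compactification (canonical_cptf R)"
proof -
  let ?e = "eval_point R"
  let ?C = "closure (range ?e)"
  \<comment> \<open>A function that keeps its value at \<open>n\<close> away from all its other
    values isolates the evaluation point of \<open>n\<close> by one coordinate. This gives both
    injectivity and discreteness of the image.\<close>
  have isol': "\<exists>U. open U \<and> U \<inter> range ?e = {?e n} \<and> (\<forall>m. ?e m \<in> U \<longrightarrow> m = n)" for n
  proof -
    obtain f \<epsilon> where f: "f \<in> R" "\<epsilon> > 0" "\<And>m. m \<noteq> n \<Longrightarrow> \<epsilon> \<le> \<bar>f m - f n\<bar>"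
      using isol by blast
    let ?U = "(\<lambda>h. h f) -` ball (f n) \<epsilon>"
    have "open ?U"
      by (auto intro!: open_vimage continuous_on_product_coordinates)
    moreover have "?e m \<in> ?U \<longleftrightarrow> m = n" for m
      using f by (force simp: eval_point_def dist_real_def abs_minus_commute)
    ultimately show ?thesis by (intro exI[of _ ?U]) auto
  qed
  have inj: "inj ?e"
    by (rule injI) (metis isol' IntD1 insertI1)
  have "subtopology (top_of_set ?C) (range ?e) = top_of_set (range ?e)"
    by (simp add: subtopology_subtopology inf.absorb2 closure_subset)
  also have "\<dots> = discrete_topology (range ?e)"
  proof (rule sym, subst discrete_topology_unique, safe)
    fix n show "openin (top_of_set (range ?e)) {?e n}"
      using isol'[of n] by (metis inf_commute openin_open)
  qed auto
  finally have "embedding_map (discrete_topology UNIV) (top_of_set ?C) ?e"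
    using inj unfolding embedding_map_def
    by (auto intro!: bijective_open_imp_homeomorphic_map simp: open_map_def)
  moreover have "compact_space (top_of_set ?C)"
    using compact_closure_eval_points[OF bdd] by (simp add: compact_space_subtopology)
  moreover have "Hausdorff_space (top_of_set ?C)"
    by (simp add: Hausdorff_space_subtopology Hausdorff_euclidean_t2)
  moreover have "top_of_set ?C closure_of range ?e = ?C"
    by (simp add: closure_of_subtopology inf.absorb2 closure_subset)
  ultimately show ?thesis
    by (simp add: compactification_def canonical_cptf_def)
qed

lemma subset_cptf_ring_canonical:
  assumes bdd: "\<And>f. f \<in> R \<Longrightarrow> bounded (range f)"
  shows "R \<subseteq> cptf_ring (canonical_cptf R)"
proof
  fix f assume f: "f \<in> R"
  have "continuous_on (closure (range (eval_point R))) (\<lambda>x. x f)"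
    by (rule continuous_on_subset[OF continuous_on_product_coordinates]) simp
  with f bdd show "f \<in> cptf_ring (canonical_cptf R)"
    unfolding cptf_ring_def canonical_cptf_def
    by (auto intro!: exI[of _ "\<lambda>x. x f"] simp: eval_point_def)
qed

text \<open>Stone-Weierstrass on the closure of the evaluation points: a continuous function there
  is a uniform limit of functions whose traces on \<omega> lie in \<open>R\<close>, and
  \<open>R\<close> is uniformly closed.\<close>

lemma cptf_ring_canonical:
  assumes bdd: "\<And>f. f \<in> R \<Longrightarrow> bounded (range f)"
    and add: "\<And>f g. f \<in> R \<Longrightarrow> g \<in> R \<Longrightarrow> (\<lambda>n. f n + g n) \<in> R"
    and mult: "\<And>f g. f \<in> R \<Longrightarrow> g \<in> R \<Longrightarrow> (\<lambda>n. f n * g n) \<in> R"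
    and const: "\<And>c. (\<lambda>_. c) \<in> R"
    and lim: "\<And>f. (\<And>\<epsilon>. \<epsilon> > 0 \<Longrightarrow> \<exists>g\<in>R. \<forall>n. \<bar>f n - g n\<bar> < \<epsilon>) \<Longrightarrow> f \<in> R"
  shows "cptf_ring (canonical_cptf R) = R"
proof (rule antisym[OF _ subset_cptf_ring_canonical[OF bdd]])
  let ?e = "eval_point R"
  let ?C = "closure (range ?e)"
  define A where "A = {F. continuous_on ?C F \<and> (\<lambda>n. F (?e n)) \<in> R}"
  interpret function_ring_on A ?C
  proof
    show "compact ?C" by (rule compact_closure_eval_points[OF bdd])
    fix x y assume xy: "x \<in> ?C" "y \<in> ?C" "x \<noteq> y"
    then obtain f where f: "x f \<noteq> y f" by auto
    \<comment> \<open>All points of the closure vanish at coordinates outside \<open>R\<close>, so a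
      coordinate that tells two of them apart belongs to \<open>R\<close> and is a separating member
      of \<open>A\<close>.\<close>
    have "f \<in> R"
    proof (rule ccontr)
      assume "f \<notin> R"
      then have "range ?e \<subseteq> (\<lambda>h. h f) -` {0}" by (auto simp: eval_point_def)
      moreover have "closed ((\<lambda>h::(nat\<Rightarrow>real)\<Rightarrow>real. h f) -` {0})"
        by (auto intro!: closed_vimage continuous_on_product_coordinates)
      ultimately have "?C \<subseteq> (\<lambda>h. h f) -` {0}" by (rule closure_minimal)
      then have "x f = 0" "y f = 0" using xy by auto
      then show False using f by simp
    qed
    then have "(\<lambda>h. h f) \<in> A"
      unfolding A_def by (simp add: eval_point_def continuous_on_subset[OF continuous_on_product_coordinates])
    then show "\<exists>F\<in>A. F x \<noteq> F y"
      by (rule rev_bexI) (rule f)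
  qed (auto simp: A_def intro!: continuous_intros add mult const)
  show "cptf_ring (canonical_cptf R) \<subseteq> R"
  proof
    fix f assume "f \<in> cptf_ring (canonical_cptf R)"
    then obtain F where F: "continuous_on ?C F" "\<And>n. F (?e n) = f n"
      by (auto simp: cptf_ring_def canonical_cptf_def)
    show "f \<in> R"
    proof (rule lim)
      fix \<epsilon> :: real assume "\<epsilon> > 0"
      then obtain G where "G \<in> A" and G: "\<And>x. x \<in> ?C \<Longrightarrow> \<bar>F x - G x\<bar> < \<epsilon>"
        using Stone_Weierstrass_basic[OF F(1)] by blast
      moreover have "?e n \<in> ?C" for n
        by (rule subsetD[OF closure_subset]) simp
      ultimately show "\<exists>g\<in>R. \<forall>n. \<bar>f n - g n\<bar> < \<epsilon>"
        by (intro bexI[of _ "\<lambda>n. G (?e n)"]) (auto simp: A_def simp flip: F(2))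
    qed
  qed
qed


section \<open>Stone-Cech and Smirnov compactifications\<close>

text \<open>The canonical compactification for the ring of all bounded functions lies above all
  others, so the choice in \<open>stone_cech\<close> has a witness. The compactification chosen lies
  above this witness in turn, so its ring is also that of all bounded functions.\<close>

lemma stone_cech:
  shows compactification_stone_cech: "compactification stone_cech"
    and cptf_ring_stone_cech: "cptf_ring stone_cech = {f. bounded (range f)}"
proof -
  let ?B = "{f :: nat \<Rightarrow> real. bounded (range f)}"
  have comp: "compactification (canonical_cptf ?B)"
  proof (rule compactification_canonical)
    fix n :: nat
    have "bounded (range (indicator {n} :: nat \<Rightarrow> real))"
      by (auto simp: bounded_iff indicator_def intro!: exI[of _ 1])
    then show "\<exists>f\<in>?B. \<exists>\<epsilon>>0. \<forall>m. m \<noteq> n \<longrightarrow> \<epsilon> \<le> \<bar>f m - f n\<bar>"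
      by (intro bexI[of _ "indicator {n}"] exI[of _ 1]) (auto simp: indicator_def)
  qed auto
  have B: "?B \<subseteq> cptf_ring (canonical_cptf ?B)"
    by (rule subset_cptf_ring_canonical) auto
  then have "cptf_le L (canonical_cptf ?B)" if "compactification L" for L :: omega_cptf
    using that B cptf_ring_bounded by (intro cptf_ring_subset_imp_le comp) blast+
  then have "compactification stone_cech \<and>
      (\<forall>L :: omega_cptf. compactification L \<longrightarrow> cptf_le L stone_cech)"
    unfolding stone_cech_def
    by (intro someI[where x = "canonical_cptf ?B" and P = "\<lambda>K. compactification K \<and>
      (\<forall>L :: omega_cptf. compactification L \<longrightarrow> cptf_le L K)"]) (use comp in blast)
  then have "compactification stone_cech" "cptf_le (canonical_cptf ?B) stone_cech"
    using comp by blast+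
  then show "compactification stone_cech" and "cptf_ring stone_cech = ?B"
    using cptf_le_imp_ring_subset B cptf_ring_bounded by blast+
qed

lemma cptf_equiv_stone_cech_iff:
  assumes K: "compactification K"
  shows "cptf_equiv stone_cech K \<longleftrightarrow> {f. bounded (range f)} \<subseteq> cptf_ring K"
proof
  assume "cptf_equiv stone_cech K"
  then show "{f. bounded (range f)} \<subseteq> cptf_ring K"
    using cptf_le_imp_ring_subset cptf_equiv_imp_le cptf_ring_stone_cech by metis
next
  assume "{f. bounded (range f)} \<subseteq> cptf_ring K"
  then have "cptf_ring K = cptf_ring stone_cech"
    using cptf_ring_bounded unfolding cptf_ring_stone_cech by blast
  then show "cptf_equiv stone_cech K"
    using K compactification_stone_cech
    by (simp add: cptf_le_antisym cptf_ring_subset_imp_le)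
qed

text \<open>Any upper bound of the family has all bounded functions in its ring. Hence
  \<open>stone_cech\<close> is a least upper bound, so the choice in \<open>cptf_sup\<close> is met,
  and whatever is chosen is an upper bound and thus equivalent to \<open>stone_cech\<close>.\<close>

lemma cptf_equiv_stone_cech_sup:
  assumes comp: "\<And>K. K \<in> \<K> \<Longrightarrow> compactification K"
    and all: "\<And>f. bounded (range f) \<Longrightarrow> \<exists>K\<in>\<K>. f \<in> cptf_ring K"
  shows "cptf_equiv stone_cech (cptf_sup \<K>)"
proof -
  let ?upper = "\<lambda>K. compactification K \<and> (\<forall>L\<in>\<K>. cptf_le L K)"
  have ring: "{f. bounded (range f)} \<subseteq> cptf_ring K" if "?upper K" for K :: omega_cptf
    using that all cptf_le_imp_ring_subset by blast
  have "?upper (cptf_sup \<K>)"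
  proof -
    have le: "cptf_le L stone_cech" if "compactification L" for L :: omega_cptf
      using that
      by (intro cptf_ring_subset_imp_le compactification_stone_cech)
        (simp_all add: cptf_ring_stone_cech cptf_ring_bounded)
    have least: "cptf_le stone_cech K" if "?upper K" for K :: omega_cptf
      using that ring[OF that] compactification_stone_cech cptf_ring_stone_cech
      by (intro cptf_ring_subset_imp_le) auto
    have "?upper stone_cech \<and> (\<forall>K :: omega_cptf. ?upper K \<longrightarrow> cptf_le stone_cech K)"
      using compactification_stone_cech comp le least by (metis (no_types, lifting))
    then show ?thesis
      unfolding cptf_sup_def by (smt (verit, del_insts) someI_ex)
  qed
  then show ?thesis
    using ring cptf_equiv_stone_cech_iff by metis
qed

section \<open>Smirnov compactifications\<close>

lemma mem_bdd_ucont_iff: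
  assumes "d \<in> discrete_metrics"
  shows "f \<in> bdd_ucont d \<longleftrightarrow>
    bounded (range f) \<and> (\<forall>\<epsilon>>0. \<exists>\<delta>>0. \<forall>x y. d x y < \<delta> \<longrightarrow> \<bar>f x - f y\<bar> < \<epsilon>)"
proof -
  interpret Metric_space UNIV d
    using assms by (simp add: discrete_metrics_def)
  show ?thesis
    unfolding bdd_ucont_def uniformly_continuous_map_def
    by (simp add: dist_real_def commute abs_minus_commute)
qed

lemma smirnov:
  assumes d: "d \<in> discrete_metrics"
  shows compactification_smirnov: "compactification (smirnov d)"
    and cptf_ring_smirnov: "cptf_ring (smirnov d) = bdd_ucont d"
proof -
  interpret Metric_space UNIV d
    using d by (simp add: discrete_metrics_def)
  note iff = mem_bdd_ucont_iff[OF d]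
  have bdd: "bounded (range f)" if "f \<in> bdd_ucont d" for f
    using that by (simp add: bdd_ucont_def)
  have "compactification (canonical_cptf (bdd_ucont d))"
  proof (rule compactification_canonical[OF bdd])
    fix n
    have "openin mtopology {n}"
      using d by (simp add: discrete_metrics_def)
    then obtain r where r: "r > 0" "mball n r \<subseteq> {n}"
      unfolding openin_mtopology by blast
    \<comment> \<open>The truncated distance from \<open>n\<close> is bounded and 1-Lipschitz, and
      off \<open>n\<close> it stays at least \<open>min 1 r\<close>.\<close>
    define f where "f m = min 1 (d n m)" for m
    have "f \<in> bdd_ucont d"
      unfolding iff
    proof (intro conjI allI impI)
      show "bounded (range f)"
        by (auto simp: bounded_iff f_def intro!: exI[of _ 1])
      fix \<epsilon> :: real assume "\<epsilon> > 0"
      have "\<bar>f x - f y\<bar> \<le> d x y" for x y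
        using triangle[of n x y] triangle[of n y x] commute[of x y] nonneg[of x y] by (auto simp: f_def)
      with \<open>\<epsilon> > 0\<close> show "\<exists>\<delta>>0. \<forall>x y. d x y < \<delta> \<longrightarrow> \<bar>f x - f y\<bar> < \<epsilon>"
        by (intro exI[of _ \<epsilon>]) (auto intro: le_less_trans)
    qed
    moreover have "min 1 r \<le> \<bar>f m - f n\<bar>" if "m \<noteq> n" for m
      using that r by (force simp: f_def mball_def)
    ultimately show "\<exists>f\<in>bdd_ucont d. \<exists>\<epsilon>>0. \<forall>m. m \<noteq> n \<longrightarrow> \<epsilon> \<le> \<bar>f m - f n\<bar>"
      using \<open>r > 0\<close> by (intro bexI[of _ f] exI[of _ "min 1 r"]) auto
  qed
  moreover have "cptf_ring (canonical_cptf (bdd_ucont d)) = bdd_ucont d"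
  proof (rule cptf_ring_canonical[OF bdd])
    fix f g assume fg: "f \<in> bdd_ucont d" "g \<in> bdd_ucont d"
    obtain M N where M: "\<And>x. \<bar>f x\<bar> \<le> M" and N: "\<And>x. \<bar>g x\<bar> \<le> N"
      using bdd[OF fg(1)] bdd[OF fg(2)] by (auto simp: bounded_iff)
    have "M \<ge> 0" "N \<ge> 0" using M[of 0] N[of 0] by auto
    have fg': "\<exists>\<delta>>0. \<forall>x y. d x y < \<delta> \<longrightarrow> \<bar>f x - f y\<bar> < \<epsilon>"
      "\<exists>\<delta>>0. \<forall>x y. d x y < \<delta> \<longrightarrow> \<bar>g x - g y\<bar> < \<epsilon>" if "\<epsilon> > 0" for \<epsilon>
      using fg that unfolding iff by blast+
    show "(\<lambda>n. f n + g n) \<in> bdd_ucont d"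
      unfolding iff
    proof (intro conjI allI impI)
      have "norm (f x + g x) \<le> M + N" for x using M[of x] N[of x] by auto
      then show "bounded (range (\<lambda>n. f n + g n))"
        unfolding bounded_iff by blast
      fix \<epsilon> :: real assume "\<epsilon> > 0"
      then obtain \<delta>1 \<delta>2 where "\<delta>1 > 0" "\<And>x y. d x y < \<delta>1 \<Longrightarrow> \<bar>f x - f y\<bar> < \<epsilon> / 2"
        "\<delta>2 > 0" "\<And>x y. d x y < \<delta>2 \<Longrightarrow> \<bar>g x - g y\<bar> < \<epsilon> / 2"
        using fg'[of "\<epsilon> / 2"] by auto
      then show "\<exists>\<delta>>0. \<forall>x y. d x y < \<delta> \<longrightarrow> \<bar>f x + g x - (f y + g y)\<bar> < \<epsilon>"
        by (intro exI[of _ "min \<delta>1 \<delta>2"]) (auto, smt (verit) field_sum_of_halves)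
    qed
    show "(\<lambda>n. f n * g n) \<in> bdd_ucont d"
      unfolding iff
    proof (intro conjI allI impI)
      have "norm (f x * g x) \<le> M * N" for x
        using M[of x] N[of x] \<open>M \<ge> 0\<close> by (simp add: abs_mult mult_mono)
      then show "bounded (range (\<lambda>n. f n * g n))"
        unfolding bounded_iff by blast
      fix \<epsilon> :: real assume "\<epsilon> > 0"
      \<comment> \<open>The summand 1 keeps the denominator positive when both bounds are 0 and
        makes the final estimate strict.\<close>
      define \<eta> where "\<eta> = \<epsilon> / (M + N + 1)"
      have "\<eta> > 0" and \<eta>: "(M + N) * \<eta> < \<epsilon>"
        using \<open>\<epsilon> > 0\<close> \<open>M \<ge> 0\<close> \<open>N \<ge> 0\<close> by (auto simp: \<eta>_def field_simps)
      then obtain \<delta>1 \<delta>2 where \<delta>: "\<delta>1 > 0" "\<And>x y. d x y < \<delta>1 \<Longrightarrow> \<bar>f x - f y\<bar> < \<eta>"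
        "\<delta>2 > 0" "\<And>x y. d x y < \<delta>2 \<Longrightarrow> \<bar>g x - g y\<bar> < \<eta>"
        using fg'[of \<eta>] by auto
      have "\<bar>f x * g x - f y * g y\<bar> < \<epsilon>" if "d x y < min \<delta>1 \<delta>2" for x y
      proof -
        have "\<bar>f x * g x - f y * g y\<bar> = \<bar>f x * (g x - g y) + g y * (f x - f y)\<bar>"
          by (simp add: algebra_simps)
        also have "\<dots> \<le> \<bar>f x\<bar> * \<bar>g x - g y\<bar> + \<bar>g y\<bar> * \<bar>f x - f y\<bar>"
          by (metis abs_mult abs_triangle_ineq)
        also have "\<dots> \<le> M * \<eta> + N * \<eta>"
          using \<delta>(2,4)[of x y] that M[of x] N[of y] \<open>M \<ge> 0\<close> \<open>N \<ge> 0\<close>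
          by (intro add_mono mult_mono) auto
        finally show ?thesis using \<eta> by (simp add: algebra_simps)
      qed
      with \<delta> show "\<exists>\<delta>>0. \<forall>x y. d x y < \<delta> \<longrightarrow> \<bar>f x * g x - f y * g y\<bar> < \<epsilon>"
        by (intro exI[of _ "min \<delta>1 \<delta>2"]) auto
    qed
  next
    show "(\<lambda>_. c) \<in> bdd_ucont d" for c
      unfolding iff by (auto intro: exI[of _ 1])
  next
    fix f :: "nat \<Rightarrow> real"
    assume lim: "\<And>\<epsilon>. \<epsilon> > 0 \<Longrightarrow> \<exists>g\<in>bdd_ucont d. \<forall>n. \<bar>f n - g n\<bar> < \<epsilon>"
    show "f \<in> bdd_ucont d"
      unfolding iff
    proof (intro conjI allI impI)
      obtain g where g: "g \<in> bdd_ucont d" "\<And>n. \<bar>f n - g n\<bar> < 1"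
        using lim[of 1] by auto
      obtain N where N: "\<And>x. \<bar>g x\<bar> \<le> N"
        using bdd[OF g(1)] by (auto simp: bounded_iff)
      have "norm (f x) \<le> N + 1" for x using N[of x] g(2)[of x] by auto
      then show "bounded (range f)"
        unfolding bounded_iff by blast
      fix \<epsilon> :: real assume "\<epsilon> > 0"
      then obtain h where h: "h \<in> bdd_ucont d" "\<And>n. \<bar>f n - h n\<bar> < \<epsilon> / 3"
        using lim[of "\<epsilon> / 3"] by auto
      have "\<epsilon> / 3 > 0" using \<open>\<epsilon> > 0\<close> by simp
      then obtain \<delta> where \<delta>: "\<delta> > 0" "\<And>x y. d x y < \<delta> \<Longrightarrow> \<bar>h x - h y\<bar> < \<epsilon> / 3"
        using h(1) unfolding iff by blast
      have "\<bar>f x - f y\<bar> < \<epsilon>" if "d x y < \<delta>" for x y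
        using \<delta>(2)[OF that] h(2)[of x] h(2)[of y] by linarith
      with \<delta> show "\<exists>\<delta>>0. \<forall>x y. d x y < \<delta> \<longrightarrow> \<bar>f x - f y\<bar> < \<epsilon>" by blast
    qed
  qed
  ultimately have "compactification (smirnov d) \<and> cptf_ring (smirnov d) = bdd_ucont d"
    unfolding smirnov_def
    by (intro someI[where x = "canonical_cptf (bdd_ucont d)" and
          P = "\<lambda>K. compactification K \<and> cptf_ring K = bdd_ucont d"] conjI)
  then show "compactification (smirnov d)" "cptf_ring (smirnov d) = bdd_ucont d" by auto
qed

section \<open>Cardinalities\<close>

text \<open>By induction, the subsets with \<open>n + 1\<close> elements are covered by an image of
  \<open>A\<close> times the subsets with \<open>n\<close> elements, so there are at most
  \<open>|A|\<close> of each finite size. A countable union of these stays within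
  \<open>|A|\<close>.\<close>

lemma card_of_Fpow_ordLeq:
  assumes A: "infinite A"
  shows "|Fpow A| \<le>o |A|"
proof -
  define G where "G n = {X. X \<subseteq> A \<and> finite X \<and> card X = n}" for n
  have "|G n| \<le>o |A|" for n
  proof (induction n)
    case 0
    have "G 0 = {{}}" by (auto simp: G_def)
    moreover have "A \<noteq> {}" using A by auto
    ultimately show ?case by (simp add: card_of_singl_ordLeq)
  next
    case (Suc n)
    have "G (Suc n) \<subseteq> (\<lambda>(a, X). insert a X) ` (A \<times> G n)"
    proof
      fix X assume "X \<in> G (Suc n)"
      then obtain a Y where "X = insert a Y" "a \<notin> Y" "card Y = n" "X \<subseteq> A" "finite X"
        by (auto simp: G_def card_Suc_eq)
      then show "X \<in> (\<lambda>(a, X). insert a X) ` (A \<times> G n)"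
        by (auto simp: G_def intro!: rev_image_eqI[of "(a, Y)"])
    qed
    then have "|G (Suc n)| \<le>o |(\<lambda>(a, X). insert a X) ` (A \<times> G n)|"
      by (rule card_of_mono1)
    also have "|(\<lambda>(a, X). insert a X) ` (A \<times> G n)| \<le>o |A \<times> G n|"
      by (rule card_of_image)
    also have "|A \<times> G n| \<le>o |A \<times> A|"
      by (rule card_of_Times_mono2[OF Suc])
    also have "|A \<times> A| =o |A|"
      by (rule card_of_Times_same_infinite[OF A])
    finally show ?case .
  qed
  moreover have "|UNIV :: nat set| \<le>o |A|"
    using A by (simp add: infinite_iff_card_of_nat)
  ultimately have "|\<Union>n. G n| \<le>o |A|"
    using A by (intro card_of_UNION_ordLeq_infinite) auto
  moreover have "Fpow A = (\<Union>n. G n)"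
    by (auto simp: Fpow_def G_def)
  ultimately show ?thesis by simp
qed

text \<open>
  The family of all finite subsets is too large when \<open>\<Phi>\<close> is finite, but then \<open>{\<Phi>}\<close> does.
\<close>

lemma finite_subsets_directed_cover:
  obtains \<F> where "\<And>F. F \<in> \<F> \<Longrightarrow> finite F \<and> F \<subseteq> \<Phi>"
    "\<And>F G. F \<in> \<F> \<Longrightarrow> G \<in> \<F> \<Longrightarrow> F \<union> G \<in> \<F>"
    "\<And>x. x \<in> \<Phi> \<Longrightarrow> \<exists>F\<in>\<F>. x \<in> F"
    "\<Phi> \<noteq> {} \<Longrightarrow> |\<F>| \<le>o |\<Phi>|"
proof (cases "finite \<Phi>")
  case True
  have "|{\<Phi>}| \<le>o |\<Phi>|" if "\<Phi> \<noteq> {}"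
    using that by (simp add: card_of_singl_ordLeq)
  with True show ?thesis by (intro that[of "{\<Phi>}"]) auto
next
  case False
  show ?thesis
    by (rule that[of "Fpow \<Phi>"]) (auto simp: Fpow_def card_of_Fpow_ordLeq[OF False, unfolded Fpow_def])
qed

section \<open>Least cardinals; the choice is justified by well-foundedness of the order on
  cardinals\<close>

lemma least_cardinal_SomeD:
  assumes "least_cardinal P = Some \<kappa>"
  shows "Card_order \<kappa> \<and> P \<kappa> \<and> (\<forall>\<mu>. Card_order \<mu> \<and> P \<mu> \<longrightarrow> \<kappa> \<le>o \<mu>)"
proof -
  have ex: "\<exists>\<kappa>. Card_order \<kappa> \<and> P \<kappa>"
    using assms by (auto simp: least_cardinal_def split: if_splits)
  then have "\<exists>\<kappa>. Card_order \<kappa> \<and> P \<kappa> \<and> (\<forall>\<mu>. Card_order \<mu> \<and> P \<mu> \<longrightarrow> \<kappa> \<le>o \<mu>)"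
    using exists_minim_Card_order[of "{\<kappa>. Card_order \<kappa> \<and> P \<kappa>}"] by blast
  from someI_ex[OF this] show ?thesis
    using assms ex by (simp add: least_cardinal_def)
qed

lemma least_cardinal_le:
  assumes "Card_order \<kappa>" "P \<kappa>"
  obtains \<mu> where "least_cardinal P = Some \<mu>" "\<mu> \<le>o \<kappa>"
proof -
  have "least_cardinal P \<noteq> None"
    using assms by (auto simp: least_cardinal_def)
  then obtain \<mu> where "least_cardinal P = Some \<mu>" by blast
  with least_cardinal_SomeD[OF this] assms that show ?thesis by blast
qed

section \<open>Metrics from slaloms\<close>

definition block_metric :: "(nat \<Rightarrow> nat) \<Rightarrow> nat rel \<Rightarrow> nat \<Rightarrow> nat \<Rightarrow> real" where
  "block_metric b r x y = (if x = y then 0 else if (x, y) \<in> r then 1 / (real (b x) + 1) else 1)"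

text \<open>All distances within one class of \<open>r\<close> equal the same number at most 1,
  because \<open>b\<close> is constant there, and distinct points of different classes are at
  distance 1. This gives the strong triangle inequality.\<close>

lemma block_metric_discrete:
  assumes r: "equiv UNIV r" and b: "\<And>x y. (x, y) \<in> r \<Longrightarrow> b x = b y"
  shows "block_metric b r \<in> discrete_metrics"
proof -
  let ?d = "block_metric b r"
  have r_sym: "(x, y) \<in> r \<longleftrightarrow> (y, x) \<in> r" for x y
    using r by (meson equivE symE)
  have r_trans: "(x, y) \<in> r \<Longrightarrow> (y, z) \<in> r \<Longrightarrow> (x, z) \<in> r" for x y z
    using r by (meson equivE transE)
  interpret Metric_space UNIV ?d
  proof
    show "?d x y = ?d y x" for x y
      using b[of x y] r_sym[of x y] by (auto simp: block_metric_def)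
    show "?d x z \<le> ?d x y + ?d y z" for x y z
      using b[of x y] b[of y z] b[of x z] r_trans[of x y z] r_trans[of x z y] r_trans[of y x z]
        r_sym[of x y] r_sym[of y z]
      by (auto simp: block_metric_def intro: order_trans[of _ 1])
  qed (auto simp: block_metric_def divide_simps)
  have "mtopology = discrete_topology UNIV"
  proof (rule sym, subst discrete_topology_unique, safe)
    fix x
    \<comment> \<open>Every nonzero distance from \<open>x\<close> is at least this radius.\<close>
    have "mball x (1 / (real (b x) + 1)) \<subseteq> {x}"
      by (auto simp: mball_def block_metric_def split: if_splits)
    then show "openin mtopology {x}"
      unfolding openin_mtopology by (auto intro!: exI[of _ "1 / (real (b x) + 1)"])
  qed auto
  then show ?thesis
    using Metric_space_axioms by (simp add: discrete_metrics_def)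
qed

text \<open>Shrinking the relation can only increase distances, so uniform continuity becomes
  easier.\<close>

lemma bdd_ucont_block_metric_mono:
  assumes "block_metric b r \<in> discrete_metrics" "block_metric b s \<in> discrete_metrics"
    and "s \<subseteq> r"
  shows "bdd_ucont (block_metric b r) \<subseteq> bdd_ucont (block_metric b s)"
proof -
  have "block_metric b r x y \<le> block_metric b s x y" for x y
    using \<open>s \<subseteq> r\<close> by (auto simp: block_metric_def)
  then show ?thesis
    unfolding subset_iff mem_bdd_ucont_iff[OF assms(1)] mem_bdd_ucont_iff[OF assms(2)]
    by (meson le_less_trans)
qed

text \<open>The size is one more than the number of value vectors: \<open>2 * n + 3\<close> values
  for each code, and at most \<open>(n + 1)\<^sup>2\<close> codes allowed by \<open>n\<close>
  slaloms, each with at most \<open>n + 1\<close> codes at \<open>n\<close>.\<close>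

locale block_partition =
  fixes b :: "nat \<Rightarrow> nat"
  assumes card_block: "card {x. b x = n} = Suc ((2 * n + 3) ^ (n + 1)\<^sup>2)"
begin

lemma finite_block: "finite {x. b x = n}"
  using card_block[of n] by (intro card_ge_0_finite) simp

text \<open>The bound is the range of rounding: a function moved into [0, 2], multiplied by
  \<open>n + 1\<close> and rounded down takes values from 0 to \<open>2 * n + 2\<close>.\<close>

definition patterns :: "nat \<Rightarrow> (nat \<Rightarrow> nat) set" where
  "patterns n = PiE {x. b x = n} (\<lambda>_. {..2 * n + 2})"

lemma finite_patterns: "finite (patterns n)"
  unfolding patterns_def by (intro finite_PiE finite_block) auto

text \<open>Slaloms may contain numbers that code nothing; \<open>from_nat_into\<close> still turns
  these into some pattern, so the bound on values holds for every \<open>k\<close>.\<close>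

definition decode :: "nat \<Rightarrow> nat \<Rightarrow> nat \<Rightarrow> nat" where
  "decode n = from_nat_into (patterns n)"

lemma decode_le: "b x = n \<Longrightarrow> decode n k x \<le> 2 * n + 2"
proof -
  have "patterns n \<noteq> {}" by (simp add: patterns_def PiE_eq_empty_iff)
  then have "decode n k \<in> patterns n"
    unfolding decode_def by (rule from_nat_into)
  then show "b x = n \<Longrightarrow> ?thesis" by (auto simp: patterns_def)
qed

lemma decode_surj:
  assumes "\<And>x. b x = n \<Longrightarrow> g x \<le> 2 * n + 2"
  obtains k where "k < card (patterns n)" "\<And>x. b x = n \<Longrightarrow> decode n k x = g x"
proof -
  let ?g = "restrict g {x. b x = n}"
  have g: "?g \<in> patterns n"
    using assms by (auto simp: patterns_def)
  have "to_nat_on (patterns n) ?g < card (patterns n)"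
    using bij_betw_apply[OF to_nat_on_finite[OF finite_patterns] g] by simp
  moreover have "decode n (to_nat_on (patterns n) ?g) = ?g"
    unfolding decode_def using g finite_patterns by (simp add: countable_finite)
  ultimately show ?thesis by (intro that) auto
qed

definition slalom_rel :: "(nat \<Rightarrow> nat set) set \<Rightarrow> nat rel" where
  "slalom_rel F =
     {(x, y). b x = b y \<and> (\<forall>\<phi>\<in>F. \<forall>k\<in>\<phi> (b x). decode (b x) k x = decode (b x) k y)}"

definition slalom_metric :: "(nat \<Rightarrow> nat set) set \<Rightarrow> nat \<Rightarrow> nat \<Rightarrow> real" where
  "slalom_metric F = block_metric b (slalom_rel F)"

lemma slalom_metric_discrete: "slalom_metric F \<in> discrete_metrics"
  unfolding slalom_metric_def
proof (rule block_metric_discrete)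
  show "equiv UNIV (slalom_rel F)"
    by (intro equivI refl_onI symI transI) (auto simp: slalom_rel_def)
qed (auto simp: slalom_rel_def)

lemma slalom_metric_mono:
  assumes "F \<subseteq> G"
  shows "metric_preceq (slalom_metric F) (slalom_metric G)"
  unfolding metric_preceq_def slalom_metric_def
proof (rule bdd_ucont_block_metric_mono)
  show "slalom_rel G \<subseteq> slalom_rel F"
    using assms by (auto simp: slalom_rel_def)
qed (use slalom_metric_discrete in \<open>simp_all add: slalom_metric_def\<close>)

lemma slalom_rel_collision:
  assumes F: "finite F" "F \<subseteq> slaloms" and n: "card F \<le> n"
  obtains x y where "x \<noteq> y" "b x = n" "b y = n" "(x, y) \<in> slalom_rel F"
proof -
  define K where "K = (\<Union>\<phi>\<in>F. \<phi> n)"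
  have "finite K"
    using F by (auto simp: K_def slaloms_def)
  have "card K \<le> (\<Sum>\<phi>\<in>F. card (\<phi> n))"
    unfolding K_def by (rule card_UN_le[OF F(1)])
  also have "\<dots> \<le> card F * (n + 1)"
    using F(2) by (intro sum_bounded_above[THEN order_trans]) (auto simp: slaloms_def)
  also have "\<dots> \<le> (n + 1)\<^sup>2"
    using n unfolding power2_eq_square by (intro mult_mono) auto
  finally have K: "card K \<le> (n + 1)\<^sup>2" .
  \<comment> \<open>The vector of values at \<open>x\<close> of all allowed patterns; two points
    with equal vectors are related.\<close>
  let ?v = "\<lambda>x. restrict (\<lambda>k. decode n k x) K"
  have "?v ` {x. b x = n} \<subseteq> PiE K (\<lambda>_. {..2 * n + 2})"
    using decode_le by auto
  then have "card (?v ` {x. b x = n}) \<le> card (PiE K (\<lambda>_. {..2 * n + 2}))"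
    using \<open>finite K\<close> by (intro card_mono finite_PiE) auto
  also have "\<dots> = (2 * n + 3) ^ card K"
    using \<open>finite K\<close> by (simp add: card_PiE numeral_3_eq_3)
  also have "\<dots> \<le> (2 * n + 3) ^ (n + 1)\<^sup>2"
    using K by (intro power_increasing) auto
  also have "\<dots> < card {x. b x = n}"
    by (simp add: card_block)
  finally have "\<not> inj_on ?v {x. b x = n}"
    by (rule pigeonhole)
  then obtain x y where xy: "b x = n" "b y = n" "x \<noteq> y" "?v x = ?v y"
    by (auto simp: inj_on_def)
  have "decode n k x = decode n k y" if "k \<in> K" for k
    using fun_cong[OF xy(4), of k] that by simp
  then have "(x, y) \<in> slalom_rel F"
    using xy by (auto simp: slalom_rel_def K_def)
  with xy that show ?thesis by blast
qed

lemma slalom_metric_not_beta: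
  assumes F: "finite F" "F \<subseteq> slaloms"
  shows "slalom_metric F \<in> metrics_not_beta"
proof -
  note disc = slalom_metric_discrete[of F]
  have "\<forall>n. \<exists>x y. card F \<le> n \<longrightarrow> x \<noteq> y \<and> b x = n \<and> b y = n \<and> (x, y) \<in> slalom_rel F"
    using slalom_rel_collision[OF F] by metis
  then obtain X Y where XY: "\<And>n. card F \<le> n \<Longrightarrow>
      X n \<noteq> Y n \<and> b (X n) = n \<and> b (Y n) = n \<and> (X n, Y n) \<in> slalom_rel F"
    by metis
  \<comment> \<open>The indicator picks one point of each colliding pair, so it jumps by 1 across
    distances that tend to 0.\<close>
  define f :: "nat \<Rightarrow> real" where "f = indicator (X ` {card F..})"
  have "f \<notin> bdd_ucont (slalom_metric F)"
  proof
    assume "f \<in> bdd_ucont (slalom_metric F)"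
    then obtain \<delta> where \<delta>: "\<delta> > 0" "\<And>x y. slalom_metric F x y < \<delta> \<Longrightarrow> \<bar>f x - f y\<bar> < 1"
      unfolding mem_bdd_ucont_iff[OF disc] by (meson zero_less_one)
    obtain m where m: "1 / real (Suc m) < \<delta>"
      using \<delta>(1) nat_approx_posE by blast
    define n where "n = max m (card F)"
    have n: "card F \<le> n" by (simp add: n_def)
    have "1 / (real n + 1) \<le> 1 / real (Suc m)"
      by (intro divide_left_mono) (auto simp: n_def)
    then have "slalom_metric F (X n) (Y n) < \<delta>"
      using m XY[OF n] by (simp add: slalom_metric_def block_metric_def)
    moreover have "f (X n) = 1"
      using n by (simp add: f_def)
    \<comment> \<open>The block of a point determines its index, so \<open>Y n\<close> could only be
      \<open>X n\<close>.\<close>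
    moreover have "Y n \<notin> X ` {card F..}"
    proof
      assume "Y n \<in> X ` {card F..}"
      then obtain m where "card F \<le> m" "Y n = X m" by auto
      then show False using XY[of m] XY[OF n] by metis
    qed
    then have "f (Y n) = 0"
      by (simp add: f_def)
    ultimately show False
      using \<delta>(2)[of "X n" "Y n"] by simp
  qed
  moreover have "bounded (range f)"
    by (auto simp: bounded_iff f_def indicator_def intro!: exI[of _ 1])
  ultimately have "\<not> cptf_equiv stone_cech (smirnov (slalom_metric F))"
    using cptf_equiv_stone_cech_iff[OF compactification_smirnov[OF disc]] cptf_ring_smirnov[OF disc]
    by auto
  then show ?thesis
    using disc by (simp add: metrics_not_beta_def)
qed

text \<open>One slalom that captures the codes of \<open>f\<close> from some block on suffices,
  whatever else \<open>F\<close> contains: related points in late blocks have the same rounded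
  value.\<close>

lemma bounded_in_bdd_ucont_slalom_metric:
  assumes loc: "\<And>f. (\<And>n. f n < card (patterns n)) \<Longrightarrow> \<exists>\<phi>\<in>\<Phi>. \<forall>\<^sub>F n in sequentially. f n \<in> \<phi> n"
    and f: "bounded (range f)"
  obtains \<phi> where "\<phi> \<in> \<Phi>" "\<And>F. \<phi> \<in> F \<Longrightarrow> f \<in> bdd_ucont (slalom_metric F)"
proof -
  obtain M where "M > 0" and M: "\<And>x. \<bar>f x\<bar> \<le> M"
    using f by (auto simp: bounded_pos)
  define u where "u x = (f x / M + 1) * (real (b x) + 1)" for x
  define g where "g x = nat \<lfloor>u x\<rfloor>" for x
  have u: "0 \<le> u x" "u x \<le> 2 * real (b x) + 2" for x
  proof -
    have "- 1 \<le> f x / M" "f x / M \<le> 1"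
      using M[of x] \<open>M > 0\<close> by (auto simp: divide_simps abs_le_iff)
    then have "0 \<le> f x / M + 1" "f x / M + 1 \<le> 2" by auto
    then have "0 \<le> u x" "u x \<le> 2 * (real (b x) + 1)"
      unfolding u_def by (intro mult_nonneg_nonneg mult_right_mono; simp)+
    then show "0 \<le> u x" "u x \<le> 2 * real (b x) + 2" by auto
  qed
  have "g x \<le> 2 * b x + 2" for x
    using u[of x] unfolding g_def by linarith
  then have "\<exists>k<card (patterns n). \<forall>x. b x = n \<longrightarrow> decode n k x = g x" for n
    using decode_surj[of n g] by metis
  then obtain c where c: "\<And>n. c n < card (patterns n)"
      "\<And>n x. b x = n \<Longrightarrow> decode n (c n) x = g x"
    by metis
  obtain \<phi> n0 where \<phi>: "\<phi> \<in> \<Phi>" and n0: "\<And>n. n \<ge> n0 \<Longrightarrow> c n \<in> \<phi> n"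
    using loc[OF c(1)] by (auto simp: eventually_sequentially)
  have "f \<in> bdd_ucont (slalom_metric F)" if F: "\<phi> \<in> F" for F
    unfolding mem_bdd_ucont_iff[OF slalom_metric_discrete]
  proof (intro conjI allI impI f)
    fix \<epsilon> :: real assume "\<epsilon> > 0"
    \<comment> \<open>The first bound is at most 1, so distinct points closer than this are related,
      and it puts them in a block from \<open>n0\<close> on, where \<open>\<phi>\<close> contains
      the code. The second bound turns the rounding error \<open>M / (b x + 1)\<close> into less
      than \<epsilon>.\<close>
    define \<delta> where "\<delta> = min (1 / (real n0 + 1)) (\<epsilon> / M)"
    have "\<bar>f x - f y\<bar> < \<epsilon>" if less: "slalom_metric F x y < \<delta>" for x y
    proof (cases "x = y")
      case False
      have "\<delta> \<le> 1 / (real n0 + 1)" by (simp add: \<delta>_def)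
      also have "\<dots> \<le> 1" by simp
      finally have "\<delta> \<le> 1" .
      then have xy: "(x, y) \<in> slalom_rel F" and b\<delta>: "1 / (real (b x) + 1) < \<delta>"
        using less False by (auto simp: slalom_metric_def block_metric_def split: if_splits)
      then have "1 / (real (b x) + 1) < 1 / (real n0 + 1)"
        by (simp add: \<delta>_def)
      then have "n0 \<le> b x" by (simp add: field_simps)
      moreover have bxy: "b x = b y" using xy by (simp add: slalom_rel_def)
      ultimately have "g x = g y"
        using xy F n0[of "b x"] c(2)[of x "b x"] c(2)[of y "b x"] by (auto simp: slalom_rel_def)
      then have "\<bar>u x - u y\<bar> < 1"
        using u(1)[of x] u(1)[of y] unfolding g_def by linarith
      moreover have "u x - u y = (f x - f y) * ((real (b x) + 1) / M)"
        using bxy by (simp add: u_def algebra_simps diff_divide_distrib add_divide_distrib)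
      then have "\<bar>u x - u y\<bar> = \<bar>f x - f y\<bar> * ((real (b x) + 1) / M)"
        using \<open>M > 0\<close> by (simp add: abs_mult)
      ultimately have "\<bar>f x - f y\<bar> * (real (b x) + 1) < M"
        using \<open>M > 0\<close> by (simp add: pos_divide_less_eq)
      then have "\<bar>f x - f y\<bar> < M * (1 / (real (b x) + 1))"
        by (simp add: pos_less_divide_eq)
      also have "\<dots> < M * (\<epsilon> / M)"
        using b\<delta> \<open>M > 0\<close> by (intro mult_strict_left_mono) (auto simp: \<delta>_def)
      finally show ?thesis using \<open>M > 0\<close> by simp
    qed (use \<open>\<epsilon> > 0\<close> in simp)
    moreover have "\<delta> > 0"
      using \<open>\<epsilon> > 0\<close> \<open>M > 0\<close> by (simp add: \<delta>_def)
    ultimately show "\<exists>\<delta>>0. \<forall>x y. slalom_metric F x y < \<delta> \<longrightarrow> \<bar>f x - f y\<bar> < \<epsilon>"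
      by blast
  qed
  with \<phi> that show ?thesis by blast
qed

end

text \<open>The disjoint sum of sets of sizes \<open>N n\<close> is countably infinite, as no
  summand is empty. Enumerate it and take the first coordinate.\<close>

lemma ex_partition_with_block_sizes:
  assumes "\<And>n. 0 < N n"
  shows "\<exists>b :: nat \<Rightarrow> nat. \<forall>n. card {x. b x = n} = N n"
proof -
  let ?S = "SIGMA n:(UNIV :: nat set). {..<N n}"
  have "fst ` ?S = UNIV"
    using assms by (force simp: image_iff)
  then have "infinite ?S"
    by (metis finite_imageI infinite_UNIV_nat)
  then have bij: "bij_betw (from_nat_into ?S) UNIV ?S"
    by (intro bij_betw_from_nat_into) auto
  have "card {x. fst (from_nat_into ?S x) = n} = N n" for n
  proof -
    have "from_nat_into ?S ` {x. fst (from_nat_into ?S x) = n} = {n} \<times> {..<N n}"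
    proof (intro equalityI subsetI)
      fix p assume p: "p \<in> {n} \<times> {..<N n}"
      then obtain x where "p = from_nat_into ?S x"
        using bij unfolding bij_betw_def by blast
      with p show "p \<in> from_nat_into ?S ` {x. fst (from_nat_into ?S x) = n}"
        by (intro image_eqI[of _ _ x]) auto
    next
      fix p assume "p \<in> from_nat_into ?S ` {x. fst (from_nat_into ?S x) = n}"
      then obtain x where "p = from_nat_into ?S x" "fst p = n" by auto
      moreover have "from_nat_into ?S x \<in> ?S"
        using bij_betw_apply[OF bij] by blast
      ultimately show "p \<in> {n} \<times> {..<N n}" by auto
    qed
    moreover have "inj_on (from_nat_into ?S) {x. fst (from_nat_into ?S x) = n}"
      using bij by (auto simp: bij_betw_def intro: inj_on_subset)
    ultimately show ?thesis
      by (metis card_cartesian_product_singleton card_image card_lessThan)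
  qed
  then show ?thesis by (intro exI allI)
qed

theorem theorem4p3:
  shows "sp_prime \<le>\<^sub>\<infinity> localization_number"
proof (cases localization_number)
  case (Some \<kappa>)
  define N :: "nat \<Rightarrow> nat" where "N n = Suc ((2 * n + 3) ^ (n + 1)\<^sup>2)" for n
  have "\<exists>b :: nat \<Rightarrow> nat. \<forall>n. card {x. b x = n} = N n"
    by (rule ex_partition_with_block_sizes) (simp add: N_def)
  then obtain b :: "nat \<Rightarrow> nat" where b: "\<forall>n. card {x. b x = n} = N n" ..
  interpret block_partition b
    by unfold_locales (simp add: b N_def)
  \<comment> \<open>The definition of the localization number is applied with
    \<open>h n = card (patterns n)\<close>.\<close>
  obtain \<Phi> where \<Phi>: "\<Phi> \<subseteq> slaloms" "|\<Phi>| =o \<kappa>"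
    and loc: "\<And>f. (\<And>n. f n < card (patterns n)) \<Longrightarrow> \<exists>\<phi>\<in>\<Phi>. \<forall>\<^sub>F n in sequentially. f n \<in> \<phi> n"
    using least_cardinal_SomeD[OF Some[unfolded localization_number_def]] by meson
  obtain \<F> where \<F>: "\<And>F. F \<in> \<F> \<Longrightarrow> finite F \<and> F \<subseteq> \<Phi>"
    "\<And>F G. F \<in> \<F> \<Longrightarrow> G \<in> \<F> \<Longrightarrow> F \<union> G \<in> \<F>"
    "\<And>\<phi>. \<phi> \<in> \<Phi> \<Longrightarrow> \<exists>F\<in>\<F>. \<phi> \<in> F"
    "\<Phi> \<noteq> {} \<Longrightarrow> |\<F>| \<le>o |\<Phi>|"
    by (rule finite_subsets_directed_cover[of \<Phi>]) blast
  define D where "D = slalom_metric ` \<F>"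
  have covers: "\<exists>F\<in>\<F>. f \<in> bdd_ucont (slalom_metric F)" if "bounded (range f)" for f
    using bounded_in_bdd_ucont_slalom_metric[OF loc that] \<F>(3) by metis
  \<comment> \<open>Some slalom must capture the codes of the zero function; this excludes the case
    in which the family \<F> could outnumber \<Phi>.\<close>
  then have "\<Phi> \<noteq> {}"
    using bounded_in_bdd_ucont_slalom_metric[OF loc, of "\<lambda>_. 0"] by auto
  then have "|D| \<le>o |\<Phi>|"
    unfolding D_def using \<F>(4) card_of_image ordLeq_transitive by blast
  then have "|D| \<le>o \<kappa>"
    using \<Phi>(2) ordLeq_ordIso_trans by blast
  have "D \<subseteq> metrics_not_beta"
    using \<F>(1) \<Phi>(1) slalom_metric_not_beta unfolding D_def by blast
  moreover have "metric_directed D"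
    unfolding metric_directed_def D_def
  proof safe
    fix F G assume "F \<in> \<F>" "G \<in> \<F>"
    then show "\<exists>d\<in>slalom_metric ` \<F>.
        metric_preceq (slalom_metric F) d \<and> metric_preceq (slalom_metric G) d"
      by (intro bexI[of _ "slalom_metric (F \<union> G)"]) (auto intro: slalom_metric_mono \<F>(2))
  qed
  moreover have "cptf_equiv stone_cech (cptf_sup (smirnov ` D))"
  proof (rule cptf_equiv_stone_cech_sup)
    show "\<exists>K\<in>smirnov ` D. f \<in> cptf_ring K" if "bounded (range f)" for f
      using covers[OF that] by (auto simp: D_def cptf_ring_smirnov slalom_metric_discrete)
  qed (auto simp: D_def compactification_smirnov slalom_metric_discrete)
  \<comment> \<open>The cardinal \<kappa> lives on the type of slaloms, while
    \<open>sp_prime\<close> ranges over cardinals on the type of metrics. So \<open>|D|\<close> is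
    the candidate there and is compared with \<kappa> afterwards.\<close>
  ultimately have "\<exists>D'. |D'| =o |D| \<and> D' \<subseteq> metrics_not_beta \<and> metric_directed D' \<and>
      cptf_equiv stone_cech (cptf_sup (smirnov ` D'))"
    using card_of_refl by blast
  then obtain \<mu> where "sp_prime = Some \<mu>" "\<mu> \<le>o |D|"
    unfolding sp_prime_def by (rule least_cardinal_le[OF card_of_Card_order]) blast
  have "\<mu> \<le>o \<kappa>"
    using \<open>\<mu> \<le>o |D|\<close> \<open>|D| \<le>o \<kappa>\<close> by (rule ordLeq_transitive)
  then show ?thesis
    using Some \<open>sp_prime = Some \<mu>\<close> by (metis ext_card_le.simps(3))
qed simp

end
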